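(* (Family $(0,-,2)$, Painlevé IV.) Let $\theta_0,\theta_\infty\in\mathbb{C}$, and let $p,q$ be holomorphic functions of $t$ on a connected open set $U\subset\mathbb{C}$ with $q$ avoiding $0$. Put $$A_0=\begin{pmatrix}-q^2-\frac{tq}2+p&\frac1q\big(q^4+tq^3+\frac{t^2q^2}4-2pq^2-tpq+p^2-\frac{\theta_0^2}4\big)\\-q&q^2+\frac{tq}2-p\end{pmatrix},$$ $$A_1=\begin{pmatrix}\frac t2&2q^2+tq-2p+\theta_\infty\\1&-\frac t2\end{pmatrix},\quad A_2=\begin{pmatrix}1&0\\0&-1\end{pmatrix},$$ $$B=z\begin{pmatrix}\frac12&0\\0&-\frac12\end{pmatrix}+\begin{pmatrix}\frac q2+\frac t4&q^2+\frac{tq}2-p+\frac{\theta_\infty}2\\\frac12&-\frac q2-\frac t4\end{pmatrix}.$$ Then the operators $\frac{d}{dz}+\frac1zA_0+A_1+zA_2$ and $\frac{d}{dt}+B$ commute if and only if $$\frac{dq}{dt}=p,\qquad\frac{dp}{dt}=\frac{3q^3}2+tq^2+\frac18(t^2+4\theta_\infty+4)q+\frac{4p^2-\theta_0^2}{8q}.$$ This system is the Hamiltonian system $\frac{dq}{dt}=-q\frac{\partial H}{\partial p}$, $\frac{dp}{dt}=q\frac{\partial H}{\partial q}$ with $$H=-\frac{p^2}{2q}+\frac{q^3}2+\frac{tq^2}2+\frac{(t^2+4\theta_\infty+4)q}8+\frac{\theta_0^2}{8q},$$ and, with $p=q'$, it is equivalent to $$q''=\frac{(q')^2}{2q}+\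frac{3q^3}2+tq^2+\frac18(t^2+4\theta_\infty+4)q-\frac{\theta_0^2}{8q}.$$
   Context: Operators act on vector-valued functions of $(z,t)$; $\frac{d}{dz},\frac{d}{dt}$ are the partial derivatives. Two operators $\frac{d}{dz}+A$ and $\frac{d}{dt}+B$ with matrix functions $A(z,t),B(z,t)$ commute iff $\frac{\partial A}{\partial t}=\frac{\partial B}{\partial z}+AB-BA$ identically in $z,t$. In the Hamiltonian equations $H=H(p,q,t)$ with partial derivatives in the independent variables $p,q,t$; $'$ denotes $\frac{d}{dt}$. (This commutation is the isomonodromy condition for the family of connections.) *)

theory Defs
  imports "HOL-Complex_Analysis.Complex_Analysis"
begin

text \<open>Points of \<open>\<complex>\<^sup>2\<close> are pairs \<open>(z, t)\<close>. A vector-valued function is holomorphic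
  if it has a complex-linear total derivative at every point; this is only used on open sets.\<close>

definition holomorphic2_on :: "(complex \<times> complex \<Rightarrow> complex^'n) \<Rightarrow> (complex \<times> complex) set \<Rightarrow> bool"
  (infixl "holomorphic2'_on" 50) where
  "Y holomorphic2_on S \<longleftrightarrow>
     (\<forall>x\<in>S. \<exists>a b. (Y has_derivative (\<lambda>h. fst h *s a + snd h *s b)) (at x))"

definition partial_z :: "(complex \<times> complex \<Rightarrow> complex^'n) \<Rightarrow> complex \<times> complex \<Rightarrow> complex^'n" where
  "partial_z Y = (\<lambda>(z, t). \<chi> i. deriv (\<lambda>w. Y (w, t) $ i) z)"

definition partial_t :: "(complex \<times> complex \<Rightarrow> complex^'n) \<Rightarrow> complex \<times> complex \<Rightarrow> complex^'n" where
  "partial_t Y = (\<lambda>(z, t). \<chi> i. deriv (\<lambda>s. Y (z, s) $ i) t)"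

text \<open>The operators \<open>d/dz + A\<close> and \<open>d/dt + B\<close>.\<close>

definition op_z :: "(complex \<Rightarrow> complex \<Rightarrow> complex^'n^'n) \<Rightarrow>
    (complex \<times> complex \<Rightarrow> complex^'n) \<Rightarrow> complex \<times> complex \<Rightarrow> complex^'n" where
  "op_z A Y = (\<lambda>(z, t). partial_z Y (z, t) + A z t *v Y (z, t))"

definition op_t :: "(complex \<Rightarrow> complex \<Rightarrow> complex^'n^'n) \<Rightarrow>
    (complex \<times> complex \<Rightarrow> complex^'n) \<Rightarrow> complex \<times> complex \<Rightarrow> complex^'n" where
  "op_t B Y = (\<lambda>(z, t). partial_t Y (z, t) + B z t *v Y (z, t))"

text \<open>Differential operators with coefficients on \<open>D\<close> commute if they do so on all vector
  functions holomorphic on some open part of \<open>D\<close>. Local functions are admitted because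
  solutions are in general multivalued in \<open>z\<close> around \<open>0\<close>.\<close>

definition commute_on :: "(complex \<times> complex) set \<Rightarrow>
    ((complex \<times> complex \<Rightarrow> complex^'n) \<Rightarrow> complex \<times> complex \<Rightarrow> complex^'n) \<Rightarrow>
    ((complex \<times> complex \<Rightarrow> complex^'n) \<Rightarrow> complex \<times> complex \<Rightarrow> complex^'n) \<Rightarrow> bool" where
  "commute_on D L M \<longleftrightarrow>
     (\<forall>S Y. open S \<longrightarrow> S \<subseteq> D \<longrightarrow> Y holomorphic2_on S \<longrightarrow> (\<forall>x\<in>S. L (M Y) x = M (L Y) x))"

definition scale_mat :: "complex \<Rightarrow> complex^'n^'m \<Rightarrow> complex^'n^'m" (infixr "*\<^sub>M" 75) where
  "c *\<^sub>M X = (\<chi> i j. c * X $ i $ j)"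

definition mat2 :: "complex \<Rightarrow> complex \<Rightarrow> complex \<Rightarrow> complex \<Rightarrow> complex^2^2" where
  "mat2 a b c d = vector [vector [a, b], vector [c, d]]"

text \<open>In the matrices and in the Hamiltonian, \<open>p\<close>, \<open>q\<close> and \<open>t\<close> are independent variables.\<close>

definition A0 :: "complex \<Rightarrow> complex \<Rightarrow> complex \<Rightarrow> complex \<Rightarrow> complex^2^2" where
  "A0 \<theta>0 p q t = mat2
     (- (q^2) - t * q / 2 + p)
     (1 / q * (q^4 + t * q^3 + t^2 * q^2 / 4 - 2 * p * q^2 - t * p * q + p^2 - \<theta>0^2 / 4))
     (- q)
     (q^2 + t * q / 2 - p)"

definition A1 :: "complex \<Rightarrow> complex \<Rightarrow> complex \<Rightarrow> complex \<Rightarrow> complex^2^2" where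
  "A1 \<theta>inf p q t = mat2 (t / 2) (2 * q^2 + t * q - 2 * p + \<theta>inf) 1 (- (t / 2))"

definition A2 :: "complex^2^2" where
  "A2 = mat2 1 0 0 (- 1)"

definition A_mat :: "complex \<Rightarrow> complex \<Rightarrow> complex \<Rightarrow> complex \<Rightarrow> complex \<Rightarrow> complex \<Rightarrow> complex^2^2" where
  "A_mat \<theta>0 \<theta>inf p q z t = (1 / z) *\<^sub>M A0 \<theta>0 p q t + A1 \<theta>inf p q t + z *\<^sub>M A2"

definition B_mat :: "complex \<Rightarrow> complex \<Rightarrow> complex \<Rightarrow> complex \<Rightarrow> complex \<Rightarrow> complex^2^2" where
  "B_mat \<theta>inf p q z t = z *\<^sub>M mat2 (1 / 2) 0 0 (- (1 / 2)) +
     mat2 (q / 2 + t / 4) (q^2 + t * q / 2 - p + \<theta>inf / 2) (1 / 2) (- (q / 2) - t / 4)"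

text \<open>Right-hand side of the equation for \<open>dp/dt\<close>.\<close>

definition p_rhs :: "complex \<Rightarrow> complex \<Rightarrow> complex \<Rightarrow> complex \<Rightarrow> complex \<Rightarrow> complex" where
  "p_rhs \<theta>0 \<theta>inf p q t =
     3 * q^3 / 2 + t * q^2 + 1 / 8 * (t^2 + 4 * \<theta>inf + 4) * q + (4 * p^2 - \<theta>0^2) / (8 * q)"

definition PIV_system :: "complex set \<Rightarrow> complex \<Rightarrow> complex \<Rightarrow>
    (complex \<Rightarrow> complex) \<Rightarrow> (complex \<Rightarrow> complex) \<Rightarrow> bool" where
  "PIV_system U \<theta>0 \<theta>inf p q \<longleftrightarrow>
     (\<forall>t\<in>U. deriv q t = p t \<and> deriv p t = p_rhs \<theta>0 \<theta>inf (p t) (q t) t)"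

definition Ham :: "complex \<Rightarrow> complex \<Rightarrow> complex \<Rightarrow> complex \<Rightarrow> complex \<Rightarrow> complex" where
  "Ham \<theta>0 \<theta>inf p q t =
     - (p^2 / (2 * q)) + q^3 / 2 + t * q^2 / 2 + (t^2 + 4 * \<theta>inf + 4) * q / 8 + \<theta>0^2 / (8 * q)"

end

theory Submission
  imports Defs
begin

text \<open>Applied to a holomorphic vector function, the commutator of the two operators is
  multiplication by the matrix \<open>\<partial>B/\<partial>z + AB - \<partial>A/\<partial>t - BA\<close>, because mixed partial derivatives commute
  by Cauchy's integral formula; constant functions detect the vanishing of this matrix. Its (2,1)
  entry vanishes iff \<open>q' = p\<close>, after which the (1,1) entry gives the equation for \<open>p'\<close>. The (1,2)
  entry then vanishes automatically, since \<open>det A\<^sub>0\<close> does not depend on \<open>t\<close>.\<close>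

no_notation fps_nth (infixl "$" 75)

section \<open>Circle integrals depending on a parameter\<close>

lemma circlepath_mem_sphere: "0 \<le> r \<Longrightarrow> x \<in> {0..1} \<Longrightarrow> circlepath c r x \<in> sphere c r"
  using path_image_circlepath_nonneg[of r c] by (auto simp: path_image_def)

lemma continuous_on_circlepath: "continuous_on {0..1} (circlepath c r)"
  using path_circlepath by (simp add: path_def)

text \<open>After parametrizing the circle this is Leibniz's rule on the unit interval. The rule
  needs the derivative of the integrand to be jointly continuous in the point and the parameter,
  hence the last assumption.\<close>

lemma has_field_derivative_contour_integral_circlepath:
  fixes g g' :: "complex \<Rightarrow> complex \<Rightarrow> complex"
    and c :: complex and r :: real
  assumes "0 \<le> r" "convex V" "t \<in> V"
    and der: "\<And>w s. w \<in> sphere c r \<Longrightarrow> s \<in> V \<Longrightarrow> (g w has_field_derivative g' w s) (at s within V)"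
    and contg: "\<And>s. s \<in> V \<Longrightarrow> continuous_on (sphere c r) (\<lambda>w. g w s)"
    and cont: "continuous_on (sphere c r \<times> V) (\<lambda>(w, s). g' w s)"
  shows "((\<lambda>s. contour_integral (circlepath c r) (\<lambda>w. g w s)) has_field_derivative
           contour_integral (circlepath c r) (\<lambda>w. g' w t)) (at t within V)"
proof -
  let ?c = "circlepath c r"
  \<comment> \<open>The velocity of the circle in closed form, so that its continuity is
    immediate.\<close>
  define v where "v = (\<lambda>x::real. 2 * pi * \<i> * r * exp (2 * of_real pi * \<i> * x))"
  have v: "vector_derivative ?c (at x) = v x" for x
    by (simp add: vector_derivative_circlepath v_def)
  note cs = circlepath_mem_sphere[OF \<open>0 \<le> r\<close>]
  have contv: "continuous_on X v" for X
    unfolding v_def by (intro continuous_intros)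
  have "((\<lambda>s. integral (cbox 0 1) (\<lambda>x. g (?c x) s * v x)) has_field_derivative
          integral (cbox 0 1) (\<lambda>x. g' (?c x) t * v x)) (at t within V)"
  proof (rule leibniz_rule_field_derivative[OF _ _ _ \<open>t \<in> V\<close> \<open>convex V\<close>])
    show "((\<lambda>s. g (?c x) s * v x) has_field_derivative g' (?c x) s * v x) (at s within V)"
      if "s \<in> V" "x \<in> cbox 0 1" for s x
      using der[of "?c x" s] cs[of x] that by (intro DERIV_cmult_right) auto
    show "(\<lambda>x. g (?c x) s * v x) integrable_on cbox 0 1" if "s \<in> V" for s
      using cs by (intro integrable_continuous continuous_on_mult contv
          continuous_on_compose2[OF contg[OF that]]) (auto intro: continuous_on_circlepath)
    show "continuous_on (V \<times> cbox 0 1) (\<lambda>(s, x). g' (?c x) s * v x)"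
      unfolding split_beta
    proof (intro continuous_on_mult)
      show "continuous_on (V \<times> cbox 0 1) (\<lambda>y. g' (?c (snd y)) (fst y))"
        using cs
        by (intro continuous_on_compose2[OF cont[unfolded split_beta],
              where f = "\<lambda>y. (?c (snd y), fst y)", simplified]
              continuous_intros continuous_on_compose2[OF continuous_on_circlepath]) auto
    qed (auto intro!: continuous_on_compose2[OF contv] continuous_intros)
  qed
  then show ?thesis
    by (simp add: contour_integral_integral v)
qed

text \<open>The parameter space is left general because the lemma is needed for pairs: one
  coordinate is a parameter of the integrand, the other the centre of the Cauchy kernel.\<close>

lemma continuous_on_contour_integral_circlepath:
  fixes g :: "'a::topological_space \<Rightarrow> complex \<Rightarrow> complex"
    and c :: complex and r :: real
  assumes "0 \<le> r" and cont: "continuous_on (V \<times> sphere c r) (\<lambda>(s, w). g s w)"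
  shows "continuous_on V (\<lambda>s. contour_integral (circlepath c r) (g s))"
proof -
  let ?c = "circlepath c r"
  define v where "v = (\<lambda>x::real. 2 * pi * \<i> * r * exp (2 * of_real pi * \<i> * x))"
  have v: "vector_derivative ?c (at x) = v x" for x
    by (simp add: vector_derivative_circlepath v_def)
  note cs = circlepath_mem_sphere[OF \<open>0 \<le> r\<close>]
  have contv: "continuous_on X v" for X
    unfolding v_def by (intro continuous_intros)
  have "continuous_on V (\<lambda>s. integral (cbox 0 1) (\<lambda>x. g s (?c x) * v x))"
  proof (rule integral_continuous_on_param, unfold split_beta, intro continuous_on_mult)
    show "continuous_on (V \<times> cbox 0 1) (\<lambda>y. g (fst y) (?c (snd y)))"
      using cs
      by (intro continuous_on_compose2[OF cont[unfolded split_beta],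
            where f = "\<lambda>y. (fst y, ?c (snd y))", simplified]
            continuous_intros continuous_on_compose2[OF continuous_on_circlepath]) auto
  qed (auto intro!: continuous_on_compose2[OF contv] continuous_intros)
  then show ?thesis
    by (simp add: contour_integral_integral v)
qed

section \<open>Partial derivatives in two complex variables\<close>

lemma has_field_derivative_fst:
  fixes f :: "complex \<times> complex \<Rightarrow> complex"
  assumes "(f has_derivative (\<lambda>h. fst h * a + snd h * b)) (at (z, t))"
  shows "((\<lambda>w. f (w, t)) has_field_derivative a) (at z)"
proof -
  have "((\<lambda>w. f (w, t)) has_derivative (\<lambda>h. fst (h, 0::complex) * a + snd (h, 0::complex) * b)) (at z)"
    by (rule has_derivative_compose[of "\<lambda>w. (w, t)", OF _ assms]) (auto intro!: derivative_eq_intros)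
  then show ?thesis
    by (simp add: has_field_derivative_def mult_commute_abs)
qed

lemma has_field_derivative_snd:
  fixes f :: "complex \<times> complex \<Rightarrow> complex"
  assumes "(f has_derivative (\<lambda>h. fst h * a + snd h * b)) (at (z, t))"
  shows "((\<lambda>s. f (z, s)) has_field_derivative b) (at t)"
proof -
  have "((\<lambda>s. f (z, s)) has_derivative (\<lambda>h. fst (0::complex, h) * a + snd (0::complex, h) * b)) (at t)"
    by (rule has_derivative_compose[of "\<lambda>s. (z, s)", OF _ assms]) (auto intro!: derivative_eq_intros)
  then show ?thesis
    by (simp add: has_field_derivative_def mult_commute_abs)
qed

text \<open>Only pointwise total differentiability is given, so continuity of the partial
  derivatives has to be produced first. Cauchy's formula does this, and it represents both mixed
  derivatives by one integral over a circle around \<open>z\<close>, whose integrand contains the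
  derivative of \<open>f\<close> in the second variable.\<close>

lemma mixed_partials:
  fixes f :: "complex \<times> complex \<Rightarrow> complex"
  assumes "open S" and x: "(z, t) \<in> S"
    and hol: "\<And>x. x \<in> S \<Longrightarrow> \<exists>a b. (f has_derivative (\<lambda>h. fst h * a + snd h * b)) (at x)"
  obtains D where "((\<lambda>w. deriv (\<lambda>s. f (w, s)) t) has_field_derivative D) (at z)"
    and "((\<lambda>s. deriv (\<lambda>w. f (w, s)) z) has_field_derivative D) (at t)"
proof -
  have contf: "continuous_on S f"
  proof (rule continuous_at_imp_continuous_on, rule ballI)
    fix x assume "x \<in> S"
    then show "isCont f x" using hol has_derivative_continuous by blast
  qed
  have der1: "(\<lambda>w. f (w, s)) field_differentiable at u" if us: "(u, s) \<in> S" for u s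
    using hol[OF us] has_field_derivative_fst unfolding field_differentiable_def by blast
  have der2: "(\<lambda>w. f (u, w)) field_differentiable at s" if us: "(u, s) \<in> S" for u s
    using hol[OF us] has_field_derivative_snd unfolding field_differentiable_def by blast
  \<comment> \<open>A closed polydisc inside \<open>S\<close> makes Cauchy's formula available in
    each variable separately.\<close>
  obtain P Q where PQ: "open P" "open Q" "z \<in> P" "t \<in> Q" "P \<times> Q \<subseteq> S"
    using open_prod_elim[OF \<open>open S\<close> x] by (metis mem_Sigma_iff)
  obtain r1 where r1: "r1 > 0" "cball z r1 \<subseteq> P" using PQ open_contains_cball by blast
  obtain r2 where r2: "r2 > 0" "cball t r2 \<subseteq> Q" using PQ open_contains_cball by blast
  have sub: "(u, s) \<in> S" if "u \<in> cball z r1" "s \<in> cball t r2" for u s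
    using that r1 r2 PQ by blast
  define ft where "ft = (\<lambda>w s. deriv (\<lambda>s. f (w, s)) s)"
  have ft: "((\<lambda>s. f (w, s)) has_field_derivative ft w s) (at s)"
    if "w \<in> cball z r1" "s \<in> ball t r2" for w s
    using der2[OF sub] that unfolding ft_def by (simp add: field_differentiable_derivI)
  have contf1: "continuous_on (cball z r1) (\<lambda>w. f (w, s))" if "s \<in> cball t r2" for s
    using that sub by (intro continuous_on_compose2[OF contf] continuous_intros) auto
  have contf2: "continuous_on (cball t r2) (\<lambda>s. f (w, s))" if "w \<in> cball z r1" for w
    using that sub by (intro continuous_on_compose2[OF contf] continuous_intros) auto
  have holf1: "(\<lambda>w. f (w, s)) holomorphic_on ball z r1" if "s \<in> cball t r2" for s
    unfolding holomorphic_on_def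
    using that by (auto intro!: field_differentiable_at_within der1 sub)
  have holf2: "(\<lambda>s. f (w, s)) holomorphic_on ball t r2" if "w \<in> cball z r1" for w
    unfolding holomorphic_on_def
    using that by (auto intro!: field_differentiable_at_within der2 sub)
  \<comment> \<open>Joint continuity is not part of the hypotheses on \<open>f\<close>. Cauchy's
    formula for the derivative in the second variable writes \<open>ft\<close> as an integral of
    \<open>f\<close> itself, which is jointly continuous.\<close>
  have contft: "continuous_on (cball z r1 \<times> ball t r2) (\<lambda>(w, s). ft w s)"
  proof -
    have "continuous_on (cball z r1 \<times> ball t r2)
      (\<lambda>y. contour_integral (circlepath t r2) (\<lambda>u. f (fst y, u) / (u - snd y)\<^sup>2) / (2 * pi * \<i>))"
    proof (intro continuous_on_divide continuous_on_contour_integral_circlepath)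
      show "continuous_on ((cball z r1 \<times> ball t r2) \<times> sphere t r2)
        (\<lambda>(y, u). f (fst y, u) / (u - snd y)\<^sup>2)"
        unfolding split_beta using sub
        by (intro continuous_on_divide continuous_on_compose2[OF contf] continuous_intros) auto
    qed (use r2 in \<open>auto intro: continuous_intros\<close>)
    also have "?this \<longleftrightarrow> ?thesis"
      by (rule continuous_on_cong)
         (auto simp: ft_def Cauchy_contour_integral_circlepath_2[OF contf2 holf2])
    finally show ?thesis .
  qed
  \<comment> \<open>The exponent is kept free: 2 gives the derivative in the first variable, 1 gives
    Cauchy's formula for the value.\<close>
  have leib: "((\<lambda>s. contour_integral (circlepath z r1) (\<lambda>w. f (w, s) / (w - u) ^ k)) has_field_derivative
           contour_integral (circlepath z r1) (\<lambda>w. ft w s / (w - u) ^ k)) (at s)"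
    if u: "u \<in> ball z r1" and s: "s \<in> ball t r2" for k u s
  proof -
    have "((\<lambda>s. contour_integral (circlepath z r1) (\<lambda>w. f (w, s) / (w - u) ^ k)) has_field_derivative
           contour_integral (circlepath z r1) (\<lambda>w. ft w s / (w - u) ^ k)) (at s within ball t r2)"
    proof (rule has_field_derivative_contour_integral_circlepath[OF _ _ s])
      show "continuous_on (sphere z r1 \<times> ball t r2) (\<lambda>(w, s). ft w s / (w - u) ^ k)"
        unfolding split_beta using u
        by (intro continuous_on_divide continuous_on_subset[OF contft[unfolded split_beta]]
            continuous_intros) auto
      show "continuous_on (sphere z r1) (\<lambda>w. f (w, s) / (w - u) ^ k)" if "s \<in> ball t r2" for s
        using u that
        by (intro continuous_on_divide continuous_on_subset[OF contf1] continuous_intros) auto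
      show "((\<lambda>s. f (w, s) / (w - u) ^ k) has_field_derivative ft w s / (w - u) ^ k) (at s within ball t r2)"
        if "w \<in> sphere z r1" "s \<in> ball t r2" for w s
        using that by (intro DERIV_cdivide has_field_derivative_at_within[OF ft]) auto
    qed (use r1 in auto)
    then show ?thesis by (simp only: at_within_open[OF s open_ball])
  qed
  \<comment> \<open>The common value of the mixed derivatives: Cauchy's integral for the
    first-variable derivative of \<open>ft\<close> at \<open>(z, t)\<close>.\<close>
  define D where "D = contour_integral (circlepath z r1) (\<lambda>w. ft w t / (w - z)\<^sup>2) / (2 * pi * \<i>)"
  have t: "t \<in> ball t r2" and z: "z \<in> ball z r1" using r1 r2 by auto
  have "((\<lambda>s. contour_integral (circlepath z r1) (\<lambda>w. f (w, s) / (w - z)\<^sup>2) / (2 * pi * \<i>))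
          has_field_derivative D) (at t)"
    unfolding D_def by (intro DERIV_cdivide leib z t)
  then have D2: "((\<lambda>s. deriv (\<lambda>w. f (w, s)) z) has_field_derivative D) (at t)"
    by (rule has_field_derivative_transform_within_open[OF _ open_ball t])
       (simp add: Cauchy_contour_integral_circlepath_2[OF contf1 holf1] r1)
  have contft1: "continuous_on (sphere z r1) (\<lambda>w. ft w t)"
    using r2 by (intro continuous_on_compose2[OF contft[unfolded split_beta],
          where f = "\<lambda>w. (w, t)", simplified] continuous_intros) auto
  \<comment> \<open>It is not yet known that \<open>ft\<close> is holomorphic in its first variable.
    Differentiating Cauchy's formula for \<open>f\<close> in the second variable shows that
    \<open>ft\<close> is reproduced by its own Cauchy integral, and such integrals are
    differentiable in \<open>u\<close>. The exponent 1 is written out to fit the general derivative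
    rule for them.\<close>
  have int: "((\<lambda>w. ft w t / (w - u) ^ 1) has_contour_integral 2 * pi * \<i> * ft u t) (circlepath z r1)"
    if u: "u \<in> ball z r1" for u
  proof -
    have "(\<lambda>w. ft w t / (w - u) ^ 1) contour_integrable_on circlepath z r1"
      using r1 u
      by (intro contour_integrable_continuous_circlepath continuous_on_divide continuous_intros)
         (auto simp: contft1)
    moreover have "((\<lambda>s. 2 * pi * \<i> * f (u, s)) has_field_derivative
        contour_integral (circlepath z r1) (\<lambda>w. ft w t / (w - u) ^ 1)) (at t)"
      by (rule has_field_derivative_transform_within_open[OF leib[OF u t, of 1] open_ball t])
         (use u in \<open>auto intro!: contour_integral_unique Cauchy_integral_circlepath contf1 holf1
            simp: dist_norm norm_minus_commute\<close>)
    then have "contour_integral (circlepath z r1) (\<lambda>w. ft w t / (w - u) ^ 1) = 2 * pi * \<i> * ft u t"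
      by (rule DERIV_unique[OF _ DERIV_cmult[OF ft]]) (use u t in auto)
    ultimately show ?thesis
      by (metis has_contour_integral_integral)
  qed
  have "((\<lambda>u. 2 * pi * \<i> * ft u t) has_field_derivative
      of_nat 1 * contour_integral (circlepath z r1) (\<lambda>w. ft w t / (w - z) ^ Suc 1)) (at z)"
    by (rule Cauchy_next_derivative_circlepath(2)[OF _ int])
       (use r1 contft1 in auto)
  from DERIV_cdivide[OF this, of "2 * pi * \<i>"]
  have D1: "((\<lambda>u. ft u t) has_field_derivative D) (at z)"
    by (simp add: D_def power2_eq_square)
  show ?thesis
    using that[OF D1[unfolded ft_def] D2] .
qed

section \<open>The commutator of the operators and zero curvature\<close>

lemma holomorphic2_on_component:
  assumes "Y holomorphic2_on S" "x \<in> S"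
  shows "\<exists>a b. ((\<lambda>x. Y x $ i) has_derivative (\<lambda>h. fst h * a + snd h * b)) (at x)"
proof -
  obtain a b where "(Y has_derivative (\<lambda>h. fst h *s a + snd h *s b)) (at x)"
    using assms unfolding holomorphic2_on_def by blast
  from bounded_linear.has_derivative[OF bounded_linear_vec_nth this, of i]
  show ?thesis by auto
qed

text \<open>By the product rule both compositions contain the same mixed derivative \<open>D\<close>
  and the same first-order terms, \<open>B\<close> times the z-derivative and \<open>A\<close> times
  the t-derivative of \<open>Y\<close>. These cancel in the difference and leave only a matrix
  acting on \<open>Y\<close>.\<close>

lemma commutator_apply:
  fixes Y :: "complex \<times> complex \<Rightarrow> complex^'n"
  assumes "open S" and hol: "Y holomorphic2_on S" and x: "(z, t) \<in> S"
    and Bz: "\<And>i j. ((\<lambda>w. B w t $ i $ j) has_field_derivative Bz $ i $ j) (at z)"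
    and At: "\<And>i j. ((\<lambda>s. A z s $ i $ j) has_field_derivative At $ i $ j) (at t)"
  shows "op_z A (op_t B Y) (z, t) - op_t B (op_z A Y) (z, t) =
    (Bz + A z t ** B z t - At - B z t ** A z t) *v Y (z, t)"
proof -
  note comp = holomorphic2_on_component[OF hol]
  have Yz: "((\<lambda>w. Y (w, t) $ i) has_field_derivative partial_z Y (z, t) $ i) (at z)" for i
    using comp[OF x, of i] DERIV_imp_deriv
    by (auto simp: partial_z_def dest!: has_field_derivative_fst)
  have Yt: "((\<lambda>s. Y (z, s) $ i) has_field_derivative partial_t Y (z, t) $ i) (at t)" for i
    using comp[OF x, of i] DERIV_imp_deriv
    by (auto simp: partial_t_def dest!: has_field_derivative_snd)
  \<comment> \<open>The same \<open>D\<close> in both conjuncts is what makes the second-order terms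
    cancel.\<close>
  have "\<exists>D. ((\<lambda>w. partial_t Y (w, t) $ i) has_field_derivative D) (at z) \<and>
            ((\<lambda>s. partial_z Y (z, s) $ i) has_field_derivative D) (at t)" for i
  proof (rule mixed_partials[where f = "\<lambda>x. Y x $ i", OF \<open>open S\<close> x comp])
    fix D assume "((\<lambda>w. deriv (\<lambda>s. Y (w, s) $ i) t) has_field_derivative D) (at z)"
      "((\<lambda>s. deriv (\<lambda>w. Y (w, s) $ i) z) has_field_derivative D) (at t)"
    then show ?thesis
      by (intro exI[of _ D]) (simp add: partial_z_def partial_t_def)
  qed assumption
  then obtain d where
      d: "\<And>i. ((\<lambda>w. partial_t Y (w, t) $ i) has_field_derivative d i) (at z)"
         "\<And>i. ((\<lambda>s. partial_z Y (z, s) $ i) has_field_derivative d i) (at t)"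
    by metis
  define D where "D = (\<chi> i. d i)"
  have "((\<lambda>w. op_t B Y (w, t) $ i) has_field_derivative
      d i + (\<Sum>j\<in>UNIV. Bz $ i $ j * Y (z, t) $ j + partial_z Y (z, t) $ j * B z t $ i $ j)) (at z)" for i
    using DERIV_add[OF d(1) DERIV_sum[OF DERIV_mult[OF Bz Yz]]]
    by (simp add: op_t_def matrix_vector_mult_def)
  from DERIV_imp_deriv[OF this] have "deriv (\<lambda>w. op_t B Y (w, t) $ i) z =
      (D + Bz *v Y (z, t) + B z t *v partial_z Y (z, t)) $ i" for i
    by (simp add: D_def matrix_vector_mult_def sum.distrib mult.commute)
  then have 1: "partial_z (op_t B Y) (z, t) = D + Bz *v Y (z, t) + B z t *v partial_z Y (z, t)"
    by (simp add: partial_z_def vec_eq_iff)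
  have "((\<lambda>s. op_z A Y (z, s) $ i) has_field_derivative
      d i + (\<Sum>j\<in>UNIV. At $ i $ j * Y (z, t) $ j + partial_t Y (z, t) $ j * A z t $ i $ j)) (at t)" for i
    using DERIV_add[OF d(2) DERIV_sum[OF DERIV_mult[OF At Yt]]]
    by (simp add: op_z_def matrix_vector_mult_def)
  from DERIV_imp_deriv[OF this] have "deriv (\<lambda>s. op_z A Y (z, s) $ i) t =
      (D + At *v Y (z, t) + A z t *v partial_t Y (z, t)) $ i" for i
    by (simp add: D_def matrix_vector_mult_def sum.distrib mult.commute)
  then have 2: "partial_t (op_z A Y) (z, t) = D + At *v Y (z, t) + A z t *v partial_t Y (z, t)"
    by (simp add: partial_t_def vec_eq_iff)
  \<comment> \<open>The outer operator is unfolded first, so that the computed derivative of the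
    inner expression still matches.\<close>
  have "op_z A (op_t B Y) (z, t) = D + Bz *v Y (z, t) + B z t *v partial_z Y (z, t)
      + A z t *v (partial_t Y (z, t) + B z t *v Y (z, t))"
    by (simp add: op_z_def[of _ "op_t B Y"] 1) (simp add: op_t_def)
  moreover have "op_t B (op_z A Y) (z, t) = D + At *v Y (z, t) + A z t *v partial_t Y (z, t)
      + B z t *v (partial_z Y (z, t) + A z t *v Y (z, t))"
    by (simp add: op_t_def[of _ "op_z A Y"] 2) (simp add: op_z_def)
  ultimately show ?thesis
    by (simp add: matrix_vector_mult_add_rdistrib matrix_vector_mult_diff_rdistrib
        matrix_vector_right_distrib matrix_vector_mul_assoc)
qed

lemma commute_on_iff_zero_curvature:
  fixes A B :: "complex \<Rightarrow> complex \<Rightarrow> complex^'n^'n"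
  assumes "open S"
    and Bz: "\<And>z t i j. (z, t) \<in> S \<Longrightarrow> ((\<lambda>w. B w t $ i $ j) has_field_derivative Bz z t $ i $ j) (at z)"
    and At: "\<And>z t i j. (z, t) \<in> S \<Longrightarrow> ((\<lambda>s. A z s $ i $ j) has_field_derivative At z t $ i $ j) (at t)"
  shows "commute_on S (op_z A) (op_t B) \<longleftrightarrow>
    (\<forall>(z, t) \<in> S. At z t = Bz z t + A z t ** B z t - B z t ** A z t)"
proof -
  define R where "R = (\<lambda>z t. Bz z t + A z t ** B z t - At z t - B z t ** A z t)"
  have comm: "op_z A (op_t B Y) (z, t) = op_t B (op_z A Y) (z, t) \<longleftrightarrow> R z t *v Y (z, t) = 0"
    if "open T" "T \<subseteq> S" "Y holomorphic2_on T" "(z, t) \<in> T"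
    for T z t and Y :: "complex \<times> complex \<Rightarrow> complex^'n"
  proof -
    have "(z, t) \<in> S" using that by blast
    then have "op_z A (op_t B Y) (z, t) - op_t B (op_z A Y) (z, t) = R z t *v Y (z, t)"
      unfolding R_def by (intro commutator_apply[OF that(1,3,4)] Bz At)
    then show ?thesis by (metis right_minus_eq)
  qed
  have "commute_on S (op_z A) (op_t B) \<longleftrightarrow> (\<forall>(z, t) \<in> S. R z t = 0)"
  proof
    assume *: "commute_on S (op_z A) (op_t B)"
    \<comment> \<open>Constant vector functions are admissible on all of \<open>S\<close> and take
      any prescribed value, so \<open>R z t\<close> kills every vector.\<close>
    have "R z t *v v = 0" if "(z, t) \<in> S" for z t v
    proof -
      have "((\<lambda>_. v) has_derivative (\<lambda>h. fst h *s 0 + snd h *s 0)) (at x)" for x :: "complex \<times> complex"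
        by simp
      then have hol: "(\<lambda>_. v) holomorphic2_on S"
        unfolding holomorphic2_on_def by blast
      then show ?thesis
        using comm[OF \<open>open S\<close> order_refl hol that] * that \<open>open S\<close> unfolding commute_on_def by blast
    qed
    then show "\<forall>(z, t) \<in> S. R z t = 0"
      by (auto simp: matrix_eq)
  next
    assume *: "\<forall>(z, t) \<in> S. R z t = 0"
    show "commute_on S (op_z A) (op_t B)"
      unfolding commute_on_def
    proof (intro allI impI ballI)
      fix T x and Y :: "complex \<times> complex \<Rightarrow> complex^'n"
      assume T: "open T" "T \<subseteq> S" "Y holomorphic2_on T" "x \<in> T"
      obtain z t where x: "x = (z, t)" by (cases x)
      show "op_z A (op_t B Y) x = op_t B (op_z A Y) x"
        using comm[OF T(1,2,3), of z t] bspec[OF *, of "(z, t)"] T x by auto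
    qed
  qed
  also have "\<dots> \<longleftrightarrow> (\<forall>(z, t) \<in> S. At z t = Bz z t + A z t ** B z t - B z t ** A z t)"
    unfolding R_def by (intro ball_cong refl) (auto simp: algebra_simps)
  finally show ?thesis .
qed

section \<open>Trace-free two-by-two matrices\<close>

lemma mat2_nth [simp]:
  "mat2 a b c d $ 1 $ 1 = a" "mat2 a b c d $ 1 $ 2 = b"
  "mat2 a b c d $ 2 $ 1 = c" "mat2 a b c d $ 2 $ 2 = d"
  by (simp_all add: mat2_def)

lemma mat2_eq_iff: "mat2 a b c d = mat2 a' b' c' d' \<longleftrightarrow> a = a' \<and> b = b' \<and> c = c' \<and> d = d'"
  by (auto simp: vec_eq_iff forall_2)

lemma mat2_add: "mat2 a b c d + mat2 a' b' c' d' = mat2 (a + a') (b + b') (c + c') (d + d')"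
  by (simp add: vec_eq_iff forall_2)

lemma scale_mat2: "k *\<^sub>M mat2 a b c d = mat2 (k * a) (k * b) (k * c) (k * d)"
  by (simp add: vec_eq_iff forall_2 scale_mat_def)

text \<open>Trace-free matrices are closed under the bracket, so the (2,2) entry only repeats the
  (1,1) entry and three scalar equations remain.\<close>

lemma mat2_commutator_traceless:
  "mat2 a b c (- a) ** mat2 a' b' c' (- a') - mat2 a' b' c' (- a') ** mat2 a b c (- a) =
   mat2 (b * c' - b' * c) (2 * (a * b' - a' * b)) (2 * (c * a' - c' * a)) (- (b * c' - b' * c))"
  by (simp add: vec_eq_iff forall_2 matrix_matrix_mult_def sum_2 algebra_simps)

text \<open>With \<open>a\<close> the (1,1) entry of \<open>A\<^sub>0\<close>, all entries simplify: the (1,2) entry of \<open>A\<^sub>0\<close> is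
  \<open>(a\<^sup>2 - \<theta>\<^sub>0\<^sup>2/4)/q\<close> because \<open>det A\<^sub>0 = - \<theta>\<^sub>0\<^sup>2/4\<close>, and the off-diagonal parts of \<open>A\<^sub>1\<close> and \<open>B\<close>
  are affine in \<open>a\<close>.\<close>

definition A0_11 :: "complex \<Rightarrow> complex \<Rightarrow> complex \<Rightarrow> complex" where
  "A0_11 p q t = p - q^2 - t * q / 2"

lemma A_mat_eq:
  "A_mat \<theta>0 \<theta>inf p q z t = mat2
     (A0_11 p q t / z + t / 2 + z)
     (((A0_11 p q t)^2 - \<theta>0^2 / 4) / q / z + (\<theta>inf - 2 * A0_11 p q t))
     (1 - q / z)
     (- (A0_11 p q t / z + t / 2 + z))"
proof -
  have "q^4 + t * q^3 + t^2 * q^2 / 4 - 2 * p * q^2 - t * p * q + p^2 = (A0_11 p q t)^2"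
    unfolding A0_11_def by (simp add: field_simps power2_eq_square power3_eq_cube power4_eq_xxxx)
  moreover have "- (q^2) - t * q / 2 + p = A0_11 p q t" "q^2 + t * q / 2 - p = - A0_11 p q t"
    "2 * q^2 + t * q - 2 * p + \<theta>inf = \<theta>inf - 2 * A0_11 p q t"
    by (simp_all add: A0_11_def)
  ultimately show ?thesis
    unfolding A_mat_def A0_def A1_def A2_def scale_mat2 mat2_add
    by (simp only:) (simp add: mult.commute[of z q])
qed

lemma B_mat_eq:
  "B_mat \<theta>inf p q z t = mat2
     (z / 2 + q / 2 + t / 4) (\<theta>inf / 2 - A0_11 p q t) (1 / 2) (- (z / 2 + q / 2 + t / 4))"
  unfolding B_mat_def scale_mat2 mat2_add mat2_eq_iff A0_11_def by simp

text \<open>Here \<open>b\<close> is the (1,2) entry of the residue matrix at \<open>z = 0\<close>.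
  Its derivative comes from differentiating \<open>b * q = a^2 - \<theta>0^2 / 4\<close>, which
  gives \<open>b' * q + b * q' = 2 * a * a'\<close>.\<close>

lemma A_mat_has_derivative_t:
  assumes p: "(p has_field_derivative p') (at t)" and q: "(q has_field_derivative q') (at t)"
    and q0: "q t \<noteq> 0" and z: "z \<noteq> 0"
    and a: "a = A0_11 (p t) (q t) t" and a': "a' = p' - 2 * q t * q' - (q t + t * q') / 2"
    and b: "b = (a^2 - \<theta>0^2 / 4) / q t"
  shows "((\<lambda>s. A_mat \<theta>0 \<theta>inf (p s) (q s) z s $ i $ j) has_field_derivative
    mat2 (a' / z + 1 / 2) ((2 * a * a' - b * q') / q t / z - 2 * a') (- q' / z) (- (a' / z + 1 / 2))
      $ i $ j) (at t)"
proof -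
  have a: "((\<lambda>s. A0_11 (p s) (q s) s) has_field_derivative a') (at t)"
    unfolding A0_11_def a' by (auto intro!: derivative_eq_intros p q)
  have 11: "((\<lambda>s. A0_11 (p s) (q s) s / z + s / 2 + z) has_field_derivative a' / z + 1 / 2) (at t)"
    by (auto intro!: derivative_eq_intros a simp: z)
  have 12: "((\<lambda>s. ((A0_11 (p s) (q s) s)^2 - \<theta>0^2 / 4) / q s / z + (\<theta>inf - 2 * A0_11 (p s) (q s) s))
     has_field_derivative (2 * a * a' - b * q') / q t / z - 2 * a') (at t)"
    by (auto intro!: derivative_eq_intros a q DERIV_cdivide simp: q0 z \<open>a = _\<close> b field_simps power2_eq_square)
  have 21: "((\<lambda>s. 1 - q s / z) has_field_derivative - q' / z) (at t)"
    by (auto intro!: derivative_eq_intros q simp: z)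
  show ?thesis
    using 11 12 21 DERIV_minus[OF 11] exhaust_2[of i] exhaust_2[of j]
    by (auto simp only: A_mat_eq mat2_nth)
qed

lemma B_mat_has_derivative_z:
  "((\<lambda>w. B_mat \<theta>inf p q w t $ i $ j) has_field_derivative mat2 (1 / 2) 0 0 (- (1 / 2)) $ i $ j) (at z)"
proof -
  have 11: "((\<lambda>w. w / 2 + q / 2 + t / 4) has_field_derivative 1 / 2) (at z)"
    by (auto intro!: derivative_eq_intros)
  show ?thesis
    using 11 DERIV_minus[OF 11] DERIV_const[of _ "at z"] exhaust_2[of i] exhaust_2[of j]
    by (auto simp only: B_mat_eq mat2_nth)
qed

text \<open>Brings the right-hand side into the shape in which the (1,1) entry delivers it: solve
  \<open>a' = (b + q * (\<theta>inf - 2 * a)) / 2\<close> for the derivative of \<open>p\<close>,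
  with \<open>p\<close> in place of the derivative of \<open>q\<close>.\<close>

lemma p_rhs_eq:
  assumes "q \<noteq> 0" and a: "a = A0_11 p q t"
  shows "p_rhs \<theta>0 \<theta>inf p q t =
    2 * q * p + (q + t * p) / 2 + ((a^2 - \<theta>0^2 / 4) / q + q * (\<theta>inf - 2 * a)) / 2"
proof -
  \<comment> \<open>The part of the quotient by \<open>q\<close> that is singular at
    \<open>q = 0\<close>. The remainder of the numerator is divisible by \<open>q\<close>.\<close>
  define P where "P = (p^2 - \<theta>0^2 / 4) / q"
  have "a^2 - \<theta>0^2 / 4 = (p^2 - \<theta>0^2 / 4) + q * (q^3 + t * q^2 + t^2 * q / 4 - 2 * p * q - t * p)"
    unfolding a A0_11_def by (simp add: field_simps power2_eq_square power3_eq_cube)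
  then have "(a^2 - \<theta>0^2 / 4) / q = P + (q^3 + t * q^2 + t^2 * q / 4 - 2 * p * q - t * p)"
    using \<open>q \<noteq> 0\<close> unfolding P_def by (simp only: add_divide_distrib) simp
  moreover have "(4 * p^2 - \<theta>0^2) / (8 * q) = P / 2"
    using \<open>q \<noteq> 0\<close> unfolding P_def by (simp add: field_simps)
  ultimately show ?thesis
    unfolding p_rhs_def by (simp only:) (simp add: a A0_11_def field_simps power2_eq_square power3_eq_cube)
qed

text \<open>A purely algebraic statement in which \<open>p'\<close> and \<open>q'\<close> are
  arbitrary numbers. In the (2,1) and (1,1) equations everything but the coefficient of
  \<open>1/z\<close> cancels, so a single nonzero \<open>z\<close> already yields both differential
  equations.\<close>

lemma zero_curvature_iff:
  assumes "q \<noteq> 0" "z \<noteq> 0"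
    and a: "a = A0_11 p q t" and a': "a' = p' - 2 * q * q' - (q + t * q') / 2"
    and b: "b = (a^2 - \<theta>0^2 / 4) / q"
  shows "mat2 (a' / z + 1 / 2) ((2 * a * a' - b * q') / q / z - 2 * a') (- q' / z) (- (a' / z + 1 / 2)) =
      mat2 (1 / 2) 0 0 (- (1 / 2)) +
      A_mat \<theta>0 \<theta>inf p q z t ** B_mat \<theta>inf p q z t - B_mat \<theta>inf p q z t ** A_mat \<theta>0 \<theta>inf p q z t
    \<longleftrightarrow> q' = p \<and> p' = p_rhs \<theta>0 \<theta>inf p q t"
proof -
  have p: "p = a + q^2 + t * q / 2" by (simp add: a A0_11_def)
  have "2 * ((1 - q / z) * (z / 2 + q / 2 + t / 4) - 1 / 2 * (a / z + t / 2 + z)) = - p / z"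
    using \<open>z \<noteq> 0\<close> unfolding p by (simp add: field_simps power2_eq_square)
  then have e21: "- q' / z = 0 + 2 * ((1 - q / z) * (z / 2 + q / 2 + t / 4) - 1 / 2 * (a / z + t / 2 + z))
      \<longleftrightarrow> q' = p"
    using \<open>z \<noteq> 0\<close> by auto
  have "(b / z + (\<theta>inf - 2 * a)) * (1 / 2) - (\<theta>inf / 2 - a) * (1 - q / z) = (b + q * (\<theta>inf - 2 * a)) / 2 / z"
    using \<open>z \<noteq> 0\<close> by (simp add: field_simps)
  moreover have "x / z + 1 / 2 = 1 / 2 + y / z \<longleftrightarrow> x = y" for x y
    using \<open>z \<noteq> 0\<close> by (simp add: add.commute[of "1 / 2"])
  ultimately have e11: "a' / z + 1 / 2 = 1 / 2 + ((b / z + (\<theta>inf - 2 * a)) * (1 / 2) - (\<theta>inf / 2 - a) * (1 - q / z))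
      \<longleftrightarrow> a' = (b + q * (\<theta>inf - 2 * a)) / 2"
    by (simp only:)
  \<comment> \<open>The value of \<open>q'\<close> is needed because \<open>a'\<close> contains
    it.\<close>
  have e11': "a' = (b + q * (\<theta>inf - 2 * a)) / 2 \<longleftrightarrow> p' = p_rhs \<theta>0 \<theta>inf p q t" if "q' = p"
    unfolding p_rhs_eq[OF \<open>q \<noteq> 0\<close> a] a' that b by (auto simp: field_simps)
  \<comment> \<open>The constant terms in \<open>z\<close> agree by the formula for
    \<open>a'\<close>. The coefficients of \<open>1/z\<close> agree because
    \<open>(a - p) / q = - q - t / 2\<close>.\<close>
  have e12: "(2 * a * a' - b * q') / q / z - 2 * a' = 0 + 2 * ((a / z + t / 2 + z) * (\<theta>inf / 2 - a)
      - (z / 2 + q / 2 + t / 4) * (b / z + (\<theta>inf - 2 * a)))"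
    if "q' = p" and "a' = (b + q * (\<theta>inf - 2 * a)) / 2"
    unfolding that p using \<open>q \<noteq> 0\<close> \<open>z \<noteq> 0\<close> by (simp add: field_simps power2_eq_square)
  show ?thesis
    \<comment> \<open>Regrouping isolates the bracket; the (2,2) equation then becomes the negative
      of the (1,1) equation.\<close>
    unfolding A_mat_eq B_mat_eq a[symmetric] b[symmetric] add_diff_eq[symmetric]
      mat2_commutator_traceless mat2_add mat2_eq_iff
      minus_add_distrib[symmetric] neg_equal_iff_equal
    using e21 e11 e11' e12 by blast
qed

section \<open>The Hamiltonian form and the second-order equation\<close>

lemma deriv_Ham_p:
  assumes "q \<noteq> 0"
  shows "deriv (\<lambda>p. Ham \<theta>0 \<theta>inf p q t) p = - p / q"
proof -
  \<comment> \<open>All terms of the Hamiltonian free of \<open>p\<close>; what is left is a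
    multiple of \<open>p^2\<close>.\<close>
  define c where "c = Ham \<theta>0 \<theta>inf 0 q t"
  have "(\<lambda>p. Ham \<theta>0 \<theta>inf p q t) = (\<lambda>p. p^2 * (- 1 / (2 * q)) + c)"
    by (auto simp: Ham_def c_def)
  moreover have "((\<lambda>p. p^2 * (- 1 / (2 * q)) + c) has_field_derivative - p / q) (at p)"
    using assms by (auto intro!: derivative_eq_intros)
  ultimately show ?thesis
    by (simp add: DERIV_imp_deriv)
qed

text \<open>The factor \<open>q\<close> is the one in the Hamiltonian equations; it turns the poles
  \<open>1/q^2\<close> of the derivative into the simple poles of \<open>p_rhs\<close>.\<close>

lemma deriv_Ham_q:
  assumes "q \<noteq> 0"
  shows "q * deriv (\<lambda>q. Ham \<theta>0 \<theta>inf p q t) q = p_rhs \<theta>0 \<theta>inf p q t"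
proof -
  have "deriv (\<lambda>q. Ham \<theta>0 \<theta>inf p q t) q = p^2 / (2 * q^2) + 3 * q^2 / 2 + t * q
      + (t^2 + 4 * \<theta>inf + 4) / 8 - \<theta>0^2 / (8 * q^2)"
    unfolding Ham_def
    by (rule DERIV_imp_deriv)
       (auto intro!: derivative_eq_intros simp: assms field_simps power2_eq_square power3_eq_cube)
  then show ?thesis
    unfolding p_rhs_def using assms by (simp only:) (simp add: field_simps power2_eq_square power3_eq_cube)
qed


theorem mainTheorem16:
  fixes \<theta>0 \<theta>inf :: complex
    and p q :: "complex \<Rightarrow> complex"
    and U :: "complex set"
  assumes "open U" and "connected U"
    and "p holomorphic_on U" and "q holomorphic_on U"
    and "\<forall>t\<in>U. q t \<noteq> 0"
  shows
    "(commute_on ((- {0}) \<times> U)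
        (op_z (\<lambda>z t. A_mat \<theta>0 \<theta>inf (p t) (q t) z t))
        (op_t (\<lambda>z t. B_mat \<theta>inf (p t) (q t) z t))
      \<longleftrightarrow> PIV_system U \<theta>0 \<theta>inf p q)
    \<and> (\<forall>x y t. y \<noteq> 0 \<longrightarrow>
        x = - y * deriv (\<lambda>x. Ham \<theta>0 \<theta>inf x y t) x \<and>
        p_rhs \<theta>0 \<theta>inf x y t = y * deriv (\<lambda>y. Ham \<theta>0 \<theta>inf x y t) y)
    \<and> (PIV_system U \<theta>0 \<theta>inf p q \<longleftrightarrow> (\<forall>t\<in>U.
        deriv q t = - q t * deriv (\<lambda>x. Ham \<theta>0 \<theta>inf x (q t) t) (p t) \<and>
        deriv p t = q t * deriv (\<lambda>y. Ham \<theta>0 \<theta>inf (p t) y t) (q t)))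
    \<and> (PIV_system U \<theta>0 \<theta>inf p q \<longleftrightarrow>
        (\<forall>t\<in>U. p t = deriv q t) \<and>
        (\<forall>t\<in>U. deriv (deriv q) t =
           (deriv q t)^2 / (2 * q t) + 3 * (q t)^3 / 2 + t * (q t)^2
           + 1 / 8 * (t^2 + 4 * \<theta>inf + 4) * q t - \<theta>0^2 / (8 * q t)))"
proof (intro conjI)
  note q0 = \<open>\<forall>t\<in>U. q t \<noteq> 0\<close>
  define a where "a = (\<lambda>t. A0_11 (p t) (q t) t)"
  define a' where "a' = (\<lambda>t. deriv p t - 2 * q t * deriv q t - (q t + t * deriv q t) / 2)"
  define b where "b = (\<lambda>t. ((a t)^2 - \<theta>0^2 / 4) / q t)"
  define At where "At = (\<lambda>z t. mat2 (a' t / z + 1 / 2)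
    ((2 * a t * a' t - b t * deriv q t) / q t / z - 2 * a' t) (- deriv q t / z) (- (a' t / z + 1 / 2)))"
  have "open ((- {0 :: complex}) \<times> U)"
    using \<open>open U\<close> by (intro open_Times) auto
  then have "commute_on ((- {0}) \<times> U)
        (op_z (\<lambda>z t. A_mat \<theta>0 \<theta>inf (p t) (q t) z t))
        (op_t (\<lambda>z t. B_mat \<theta>inf (p t) (q t) z t))
    \<longleftrightarrow> (\<forall>(z, t) \<in> (- {0}) \<times> U. At z t = mat2 (1 / 2) 0 0 (- (1 / 2)) +
      A_mat \<theta>0 \<theta>inf (p t) (q t) z t ** B_mat \<theta>inf (p t) (q t) z t -
      B_mat \<theta>inf (p t) (q t) z t ** A_mat \<theta>0 \<theta>inf (p t) (q t) z t)"
  proof (rule commute_on_iff_zero_curvature[OF _ B_mat_has_derivative_z])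
    fix z t :: complex and i j assume zt: "(z, t) \<in> (- {0}) \<times> U"
    then have p: "(p has_field_derivative deriv p t) (at t)"
      and q: "(q has_field_derivative deriv q t) (at t)"
      using assms holomorphic_derivI by blast+
    show "((\<lambda>s. A_mat \<theta>0 \<theta>inf (p s) (q s) z s $ i $ j) has_field_derivative At z t $ i $ j) (at t)"
      unfolding At_def using zt q0
      by (intro A_mat_has_derivative_t[OF p q]) (auto simp: a_def a'_def b_def)
  qed
  also have "\<dots> \<longleftrightarrow> (\<forall>(z, t) \<in> (- {0 :: complex}) \<times> U. deriv q t = p t \<and> deriv p t = p_rhs \<theta>0 \<theta>inf (p t) (q t) t)"
  proof (rule ball_cong[OF refl])
    fix x assume "x \<in> (- {0 :: complex}) \<times> U"
    then obtain z t where x: "x = (z, t)" "z \<noteq> 0" "t \<in> U" by auto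
    with q0 have "At z t = mat2 (1 / 2) 0 0 (- (1 / 2)) +
      A_mat \<theta>0 \<theta>inf (p t) (q t) z t ** B_mat \<theta>inf (p t) (q t) z t -
      B_mat \<theta>inf (p t) (q t) z t ** A_mat \<theta>0 \<theta>inf (p t) (q t) z t \<longleftrightarrow>
      deriv q t = p t \<and> deriv p t = p_rhs \<theta>0 \<theta>inf (p t) (q t) t"
      unfolding At_def by (intro zero_curvature_iff) (auto simp: a_def a'_def b_def)
    then show "(case x of (z, t) \<Rightarrow> At z t = mat2 (1 / 2) 0 0 (- (1 / 2)) +
      A_mat \<theta>0 \<theta>inf (p t) (q t) z t ** B_mat \<theta>inf (p t) (q t) z t -
      B_mat \<theta>inf (p t) (q t) z t ** A_mat \<theta>0 \<theta>inf (p t) (q t) z t) \<longleftrightarrow>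
      (case x of (z, t) \<Rightarrow> deriv q t = p t \<and> deriv p t = p_rhs \<theta>0 \<theta>inf (p t) (q t) t)"
      by (simp only: x prod.case)
  qed
  \<comment> \<open>The condition no longer involves \<open>z\<close>, and the punctured plane is
    nonempty: \<open>z = 1\<close> serves as witness.\<close>
  also have "\<dots> \<longleftrightarrow> PIV_system U \<theta>0 \<theta>inf p q"
    unfolding PIV_system_def by (auto intro: exI[of _ 1])
  finally show "commute_on ((- {0}) \<times> U)
        (op_z (\<lambda>z t. A_mat \<theta>0 \<theta>inf (p t) (q t) z t))
        (op_t (\<lambda>z t. B_mat \<theta>inf (p t) (q t) z t))
      \<longleftrightarrow> PIV_system U \<theta>0 \<theta>inf p q" .
  show "\<forall>x y t. y \<noteq> 0 \<longrightarrow>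
        x = - y * deriv (\<lambda>x. Ham \<theta>0 \<theta>inf x y t) x \<and>
        p_rhs \<theta>0 \<theta>inf x y t = y * deriv (\<lambda>y. Ham \<theta>0 \<theta>inf x y t) y"
    by (simp add: deriv_Ham_p deriv_Ham_q)
  show "PIV_system U \<theta>0 \<theta>inf p q \<longleftrightarrow> (\<forall>t\<in>U.
        deriv q t = - q t * deriv (\<lambda>x. Ham \<theta>0 \<theta>inf x (q t) t) (p t) \<and>
        deriv p t = q t * deriv (\<lambda>y. Ham \<theta>0 \<theta>inf (p t) y t) (q t))"
    unfolding PIV_system_def using q0 by (simp add: deriv_Ham_p deriv_Ham_q)
  have rhs: "p_rhs \<theta>0 \<theta>inf x y t = x^2 / (2 * y) + 3 * y^3 / 2 + t * y^2
           + 1 / 8 * (t^2 + 4 * \<theta>inf + 4) * y - \<theta>0^2 / (8 * y)" for x y t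
    by (simp add: p_rhs_def diff_divide_distrib)
  \<comment> \<open>The functions \<open>p\<close> and \<open>deriv q\<close> agree only on
    \<open>U\<close>; as \<open>U\<close> is open they agree near each of its points and so have the
    same derivative there.\<close>
  have deriv2: "deriv (deriv q) t = deriv p t" if "\<forall>t\<in>U. p t = deriv q t" "t \<in> U" for t
    using that \<open>open U\<close> by (intro deriv_cong_ev) (auto simp: eventually_nhds)
  show "PIV_system U \<theta>0 \<theta>inf p q \<longleftrightarrow>
        (\<forall>t\<in>U. p t = deriv q t) \<and>
        (\<forall>t\<in>U. deriv (deriv q) t =
           (deriv q t)^2 / (2 * q t) + 3 * (q t)^3 / 2 + t * (q t)^2
           + 1 / 8 * (t^2 + 4 * \<theta>inf + 4) * q t - \<theta>0^2 / (8 * q t))"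
    unfolding PIV_system_def rhs[symmetric] using deriv2 by (metis (lifting))
qed

thm_deps mainTheorem16

end
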